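(* Let $\alpha\in(1/2,1)$, $p\in(1,\infty]$, $\varepsilon\ge0$, let $F^*$ be a probability distribution on $\mathbb{R}^{d+1}$ with finite first moment, and let $\widehat F_N$ be the empirical distribution of a sample of size $N$. Let $(\widetilde{\boldsymbol\beta}_N,\widetilde s_N)$ be a minimizer of $$\inf_{(\boldsymbol\beta,s)\in\mathbb{R}^{d+1}}\Big\{\mathbb{E}^{\widehat F_N}[\ell_\alpha(Y-\boldsymbol\beta^\top\mathbf{X}-s)]+c_{\alpha,p}\,\varepsilon\,\|(\boldsymbol\beta,-1)\|_*\Big\},$$ put $$\Delta s=\frac{\varepsilon}{q}\big(\alpha^q-(1-\alpha)^q\big)c_{\alpha,p}^{1-q}\,\|(\widetilde{\boldsymbol\beta}_N,-1)\|_*,$$ and let $(\widehat{\boldsymbol\beta}_N,\widehat s_N)=(\widetilde{\boldsymbol\beta}_N,\widetilde s_N+\Delta s)$ be the corresponding optimal solution of the Wasserstein distributionally robust problem $\inf_{\boldsymbol\beta,s}\sup_{F\in\mathbb{B}_p(\widehat F_N,\varepsilon)}\mathbb{E}^F[\ell_\alpha(Y-\boldsymbol\beta^\top\mathbf{X}-s)]$. Define the out-of-sample risks $\widetilde J_{\rm oos}=\mathbb{E}^{F^*}[\ell_\alpha(Y-\widetilde{\boldsymbol\beta}_N^\top\mathbf{X}-\widetilde s_N)]$ and $J_{\rm oos}=\mathbb{E}^{F^*}[\ell_\alpha(Y-\widehat{\boldsymbol\beta}_N^\top\mathbf{X}-\widehat s_N)]$, and write $R=Y-\widetilde{\boldsymbol\beta}_N^\top\mathbf{X}-\widetilde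 s_N$. Then $$\widetilde J_{\rm oos}-J_{\rm oos}=\Delta s\,\big(\alpha-\mathbb{P}^{F^*}(R<\Delta s)\big)+\mathbb{E}^{F^*}\big[R\,\mathbf{1}_{\{R\in[0,\Delta s)\}}\big]=\int_0^{\Delta s}\big[\alpha-\mathbb{P}^{F^*}(R\le y)\big]\,dy.$$
   Context: The check loss is $\ell_\alpha(u)=u(\alpha-\mathbf{1}_{\{u<0\}})$. $q$ is the Hölder conjugate of $p$ ($q=1$ when $p=\infty$). $\|\cdot\|$ is a fixed norm on $\mathbb{R}^{d+1}$ with dual norm $\|\mathbf{y}\|_*=\sup_{\|\mathbf{x}\|\le1}\mathbf{x}^\top\mathbf{y}$. $c_{\alpha,p}=(\alpha^q(1-\alpha)+\alpha(1-\alpha)^q)^{1/q}$ for $p\in(1,\infty)$ and $c_{\alpha,\infty}=2\alpha(1-\alpha)$. $\mathbb{B}_p(\widehat F_N,\varepsilon)$ is the set of probability distributions on $\mathbb{R}^{d+1}$ at type-$p$ Wasserstein distance (with ground metric $\|\cdot\|$) at most $\varepsilon$ from $\widehat F_N$. $\mathbb{E}^{F^*}$, $\mathbb{P}^{F^*}$ refer to $(\mathbf{X},Y)\sim F^*$ with the sample (hence the estimators) held fixed. *)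

theory Defs
  imports "HOL-Probability.Probability"
begin

definition check_loss :: "real \<Rightarrow> real \<Rightarrow> real" where
  "check_loss \<alpha> u = u * (\<alpha> - (if u < 0 then 1 else 0))"

text \<open>A data point is a pair \<open>(x, y)\<close> of a covariate vector and a response; the space
  \<open>\<real>\<^sup>d\<^sup>+\<^sup>1\<close> is rendered as the product of \<open>real ^ 'n\<close> (with \<open>d = CARD('n)\<close>) and \<open>real\<close>.\<close>

definition residual :: "real ^ 'n \<Rightarrow> real \<Rightarrow> (real ^ 'n) \<times> real \<Rightarrow> real" where
  "residual \<beta> s z = snd z - \<beta> \<bullet> fst z - s"

text \<open>Non-negativity of \<open>N\<close> follows from the three conditions.\<close>

definition is_norm :: "('a::real_vector \<Rightarrow> real) \<Rightarrow> bool" where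
  "is_norm N \<longleftrightarrow>
     (\<forall>x. N x = 0 \<longleftrightarrow> x = 0) \<and>
     (\<forall>c x. N (c *\<^sub>R x) = \<bar>c\<bar> * N x) \<and>
     (\<forall>x y. N (x + y) \<le> N x + N y)"

definition dual_norm :: "('a::real_inner \<Rightarrow> real) \<Rightarrow> 'a \<Rightarrow> real" where
  "dual_norm N y = (SUP x \<in> {x. N x \<le> 1}. x \<bullet> y)"

definition holder_conj :: "ereal \<Rightarrow> real" where
  "holder_conj p = (if p = \<infinity> then 1 else real_of_ereal p / (real_of_ereal p - 1))"

definition c_const :: "real \<Rightarrow> ereal \<Rightarrow> real" where
  "c_const \<alpha> p =
     (if p = \<infinity> then 2 * \<alpha> * (1 - \<alpha>)
      else (let q = holder_conj p in
        (\<alpha> powr q * (1 - \<alpha>) + \<alpha> * (1 - \<alpha>) powr q) powr (1 / q)))"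

definition empirical_distribution :: "nat \<Rightarrow> (nat \<Rightarrow> 'a::topological_space) \<Rightarrow> 'a measure" where
  "empirical_distribution n sample = distr (uniform_count_measure {..<n}) borel sample"

definition couplings :: "'a::topological_space measure \<Rightarrow> 'a measure \<Rightarrow> ('a \<times> 'a) measure set" where
  "couplings F G = {\<pi>. prob_space \<pi> \<and> sets \<pi> = sets (borel \<Otimes>\<^sub>M borel) \<and>
     distr \<pi> borel fst = F \<and> distr \<pi> borel snd = G}"

text \<open>The transport cost takes values in \<open>[0, \<infinity>]\<close>, so distributions without finite \<open>p\<close>-th moment
  need no separate treatment; the case distinction for \<open>p < \<infinity>\<close> is the \<open>p\<close>-th root on \<open>[0, \<infinity>]\<close>.\<close>

definition wasserstein_dist ::
    "('a::{topological_space,minus} \<Rightarrow> real) \<Rightarrow> ereal \<Rightarrow> 'a measure \<Rightarrow> 'a measure \<Rightarrow> ennreal" where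
  "wasserstein_dist N p F G =
     (if p = \<infinity> then
        (INF \<pi> \<in> couplings F G. esssup \<pi> (\<lambda>(\<xi>, \<zeta>). ennreal (N (\<xi> - \<zeta>))))
      else
        (let r = real_of_ereal p;
             C = (INF \<pi> \<in> couplings F G. \<integral>\<^sup>+ (\<xi>, \<zeta>). ennreal (N (\<xi> - \<zeta>) powr r) \<partial>\<pi>)
         in if C = \<infinity> then \<infinity> else ennreal (enn2real C powr (1 / r))))"

definition wasserstein_ball ::
    "('a::{topological_space,minus} \<Rightarrow> real) \<Rightarrow> ereal \<Rightarrow> 'a measure \<Rightarrow> real \<Rightarrow> 'a measure set" where
  "wasserstein_ball N p F\<^sub>0 \<epsilon> =
     {F. prob_space F \<and> sets F = sets borel \<and> wasserstein_dist N p F F\<^sub>0 \<le> ennreal \<epsilon>}"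

definition expected_loss ::
    "real \<Rightarrow> ((real ^ 'n) \<times> real) measure \<Rightarrow> real ^ 'n \<Rightarrow> real \<Rightarrow> real" where
  "expected_loss \<alpha> F \<beta> s = (\<integral>z. check_loss \<alpha> (residual \<beta> s z) \<partial>F)"

definition regularized_objective ::
    "((real ^ 'n) \<times> real \<Rightarrow> real) \<Rightarrow> real \<Rightarrow> ereal \<Rightarrow> real \<Rightarrow> ((real ^ 'n) \<times> real) measure \<Rightarrow>
     (real ^ 'n) \<times> real \<Rightarrow> real" where
  "regularized_objective N \<alpha> p \<epsilon> F\<^sub>0 = (\<lambda>(\<beta>, s).
     expected_loss \<alpha> F\<^sub>0 \<beta> s + c_const \<alpha> p * \<epsilon> * dual_norm N (\<beta>, -1))"

text \<open>The check loss is non-negative for \<open>0 \<le> \<alpha> \<le> 1\<close>, so the expectations can be taken as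
  \<open>[0, \<infinity>]\<close>-valued integrals; the supremum is then the true one, infinite or not.\<close>

definition worst_case_risk ::
    "((real ^ 'n) \<times> real \<Rightarrow> real) \<Rightarrow> real \<Rightarrow> ereal \<Rightarrow> real \<Rightarrow> ((real ^ 'n) \<times> real) measure \<Rightarrow>
     (real ^ 'n) \<times> real \<Rightarrow> ennreal" where
  "worst_case_risk N \<alpha> p \<epsilon> F\<^sub>0 = (\<lambda>(\<beta>, s).
     SUP F \<in> wasserstein_ball N p F\<^sub>0 \<epsilon>. \<integral>\<^sup>+ z. ennreal (check_loss \<alpha> (residual \<beta> s z)) \<partial>F)"

end

theory Submission
  imports Defs
begin

text \<open>The shift \<open>\<Delta>s\<close> is non-negative, and everything else is a statement about one integrable
  random variable \<open>R\<close> and one constant \<open>d \<ge> 0\<close>: shifting the intercept by \<open>d\<close> replaces the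
  residual \<open>R\<close> by \<open>R - d\<close>. The pointwise difference of the two check losses is then the piecewise
  linear function \<open>d * (\<alpha> - 1{R < d}) + R * 1{0 \<le> R < d}\<close> of \<open>R\<close>
  (\<open>check_loss_shift\<close>), whose expectation is the first formula. For the second formula, the part
  of this function that does not involve \<open>\<alpha>\<close> is minus the length of \<open>{y \<in> {0..d}. R \<le> y}\<close>;
  by Fubini's theorem its expectation is minus the integral over \<open>{0..d}\<close> of the distribution
  function of \<open>R\<close> (\<open>integral_cdf_eq_expectation\<close>).

  The inequality \<open>\<Delta>s \<ge> 0\<close> follows from \<open>\<alpha> > 1 - \<alpha>\<close>,
  from \<open>q > 0\<close>, and from the non-negativity of the dual norm. The latter needs an argument because
  a real supremum has the expected properties only on a bounded set: in finite dimension the unit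
  ball of every norm is bounded in the Euclidean norm (\<open>is_norm_unit_ball_bounded\<close>).\<close>

section \<open>Non-negativity of the shift\<close>

text \<open>A norm is convex, hence continuous in finite dimension, so it attains a minimum on the
  Euclidean unit sphere; this minimum is positive by definiteness, and homogeneity
  carries the bound to all vectors.\<close>
lemma is_norm_unit_ball_bounded:
  fixes N :: "'a::euclidean_space \<Rightarrow> real"
  assumes "is_norm N"
  shows "\<exists>c>0. \<forall>x. N x \<le> 1 \<longrightarrow> norm x \<le> c"
proof -
  have zero: "N x = 0 \<longleftrightarrow> x = 0" and scale: "N (c *\<^sub>R x) = \<bar>c\<bar> * N x"
    and triangle: "N (x + y) \<le> N x + N y" for x y c
    using assms by (auto simp: is_norm_def)
  have nonneg: "0 \<le> N x" for x
    using triangle[of x "-x"] scale[of "-1" x] zero[of 0] by simp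
  have "convex_on UNIV N"
  proof (rule convex_onI)
    fix t :: real and x y :: 'a
    assume "0 < t" "t < 1"
    then show "N ((1 - t) *\<^sub>R x + t *\<^sub>R y) \<le> (1 - t) * N x + t * N y"
      using triangle[of "(1 - t) *\<^sub>R x" "t *\<^sub>R y"] by (simp add: scale)
  qed simp
  then have "continuous_on (sphere 0 1) N"
    by (meson convex_on_continuous continuous_on_subset open_UNIV subset_UNIV)
  moreover have "sphere (0::'a) 1 \<noteq> {}" by simp
  ultimately obtain u where u: "norm u = 1" and min: "\<And>x. norm x = 1 \<Longrightarrow> N u \<le> N x"
    using continuous_attains_inf[of "sphere 0 1" N] by auto
  have pos: "0 < N u"
    using nonneg[of u] zero[of u] u by force
  have "norm x \<le> 1 / N u" if "N x \<le> 1" for x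
  proof (cases "x = 0")
    case True
    then show ?thesis using pos by simp
  next
    case False
    then have "N u \<le> N ((1 / norm x) *\<^sub>R x)" by (intro min) simp
    then have "N u * norm x \<le> N x"
      using False by (simp add: scale field_simps)
    then show ?thesis using that pos by (simp add: field_simps)
  qed
  then show ?thesis using pos by (intro exI[of _ "1 / N u"]) auto
qed

lemma dual_norm_nonneg:
  fixes N :: "'a::euclidean_space \<Rightarrow> real"
  assumes "is_norm N"
  shows "0 \<le> dual_norm N y"
proof -
  obtain c where c: "0 < c" "\<And>x. N x \<le> 1 \<Longrightarrow> norm x \<le> c"
    using is_norm_unit_ball_bounded[OF assms] by blast
  have "bdd_above ((\<lambda>x. x \<bullet> y) ` {x. N x \<le> 1})"
  proof (rule bdd_aboveI2)
    fix x assume "x \<in> {x. N x \<le> 1}"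
    then have "norm x * norm y \<le> c * norm y" by (intro mult_right_mono c) auto
    then show "x \<bullet> y \<le> c * norm y" using norm_cauchy_schwarz[of x y] by linarith
  qed
  moreover have "N 0 = 0" using assms unfolding is_norm_def by blast
  ultimately have "0 \<bullet> y \<le> dual_norm N y"
    unfolding dual_norm_def by (intro cSUP_upper) auto
  then show ?thesis by simp
qed

lemma holder_conj_pos:
  assumes "1 < p"
  shows "0 < holder_conj p"
  using assms by (cases p) (auto simp: holder_conj_def one_ereal_def)

section \<open>The check loss under a shift\<close>

text \<open>The three cases \<open>u < 0\<close>, \<open>0 \<le> u < d\<close> and \<open>d \<le> u\<close> give \<open>(\<alpha> - 1) * d\<close>,
  \<open>(\<alpha> - 1) * d + u\<close> and \<open>\<alpha> * d\<close>; only in the middle one do \<open>u\<close> and \<open>u - d\<close> have different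
  signs.\<close>
lemma check_loss_shift:
  assumes "0 \<le> d"
  shows "check_loss \<alpha> u - check_loss \<alpha> (u - d)
    = d * (\<alpha> - indicator {..<d} u) + u * indicator {0..<d} u"
  using assms by (auto simp: check_loss_def indicator_def algebra_simps)

lemma integrable_residual:
  assumes "prob_space F" "sets F = sets borel" "integrable F (\<lambda>z. norm z)"
  shows "integrable F (residual \<beta> s)"
proof -
  interpret prob_space F by fact
  have id: "integrable F (\<lambda>z. z)"
    using assms(2,3) by (subst integrable_norm_iff[symmetric]) auto
  then have "integrable F (\<lambda>z. snd z - \<beta> \<bullet> fst z - s)"
    by (intro Bochner_Integration.integrable_diff integrable_const integrable_inner_right
        integrable_bounded_linear[OF bounded_linear_snd]
        integrable_bounded_linear[OF bounded_linear_fst])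
  then show ?thesis by (simp add: residual_def[abs_def])
qed

lemma integrable_check_loss:
  assumes "integrable F X"
  shows "integrable F (\<lambda>z. check_loss \<alpha> (X z))"
proof (rule Bochner_Integration.integrable_bound)
  show "integrable F (\<lambda>z. (\<bar>\<alpha>\<bar> + 1) * X z)" using assms by simp
  show "(\<lambda>z. check_loss \<alpha> (X z)) \<in> borel_measurable F"
    using borel_measurable_integrable[OF assms] unfolding check_loss_def by measurable
  have "\<bar>check_loss \<alpha> u\<bar> \<le> \<bar>(\<bar>\<alpha>\<bar> + 1) * u\<bar>" for u
    by (auto simp: check_loss_def abs_mult mult.commute[of u] intro!: mult_right_mono)
  then show "AE z in F. norm (check_loss \<alpha> (X z)) \<le> norm ((\<bar>\<alpha>\<bar> + 1) * X z)" by simp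
qed

section \<open>Two formulas for the expected difference\<close>

context prob_space
begin

lemma expectation_check_loss_shift:
  assumes "integrable M X" "0 \<le> d"
  shows "expectation (\<lambda>z. check_loss \<alpha> (X z)) - expectation (\<lambda>z. check_loss \<alpha> (X z - d))
    = d * (\<alpha> - \<P>(z in M. X z < d)) + expectation (\<lambda>z. X z * indicator {0..<d} (X z))"
proof -
  note [measurable] = borel_measurable_integrable[OF assms(1)]
  have ind: "integrable M (\<lambda>z. indicator {..<d} (X z) :: real)"
    by (rule integrable_const_bound[of _ 1]) (auto simp: indicator_def)
  have trunc: "integrable M (\<lambda>z. X z * indicator {0..<d} (X z))"
    by (rule Bochner_Integration.integrable_bound[OF assms(1)]) (auto simp: indicator_def)
  have prob: "expectation (\<lambda>z. indicator {..<d} (X z)) = \<P>(z in M. X z < d)"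
  proof -
    have "expectation (\<lambda>z. indicator {..<d} (X z) :: real)
        = expectation (indicator {z \<in> space M. X z < d})"
      by (intro Bochner_Integration.integral_cong) (auto simp: indicator_def)
    then show ?thesis by simp
  qed
  have "expectation (\<lambda>z. check_loss \<alpha> (X z)) - expectation (\<lambda>z. check_loss \<alpha> (X z - d))
      = expectation (\<lambda>z. check_loss \<alpha> (X z) - check_loss \<alpha> (X z - d))"
    using assms(1) by (intro Bochner_Integration.integral_diff[symmetric] integrable_check_loss) auto
  also have "\<dots> = expectation (\<lambda>z. d * (\<alpha> - indicator {..<d} (X z)) + X z * indicator {0..<d} (X z))"
    by (simp add: check_loss_shift[OF assms(2)])
  also have "\<dots> = d * (\<alpha> - \<P>(z in M. X z < d)) + expectation (\<lambda>z. X z * indicator {0..<d} (X z))"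
    using ind trunc by (simp add: prob prob_space)
  finally show ?thesis .
qed

text \<open>Both sides are the \<open>M \<Otimes> lborel\<close>-measure of \<open>{(z, y). 0 \<le> y \<le> d \<and> X z \<le> y}\<close>:
  the section at \<open>y\<close> has probability \<open>P (X \<le> y)\<close>, and the section at \<open>z\<close> is the interval
  from \<open>max 0 (X z)\<close> to \<open>d\<close>.\<close>
lemma integral_cdf_eq_expectation:
  assumes [measurable]: "X \<in> borel_measurable M" and "0 \<le> d"
  shows "(\<lambda>y. \<P>(z in M. X z \<le> y)) integrable_on {0..d}"
    and "integral {0..d} (\<lambda>y. \<P>(z in M. X z \<le> y))
      = expectation (\<lambda>z. max 0 (d - max 0 (X z)))"
proof -
  interpret pair_sigma_finite M lborel ..
  define f :: "'a \<Rightarrow> real \<Rightarrow> real" where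
    "f z y = indicator {0..d} y * (if X z \<le> y then 1 else 0)" for z y
  have int: "integrable (M \<Otimes>\<^sub>M lborel) (\<lambda>(z, y). f z y)"
  proof (rule integrableI_bounded_set[where A = "space M \<times> {0..d}" and B = 1])
    show "(\<lambda>(z, y). f z y) \<in> borel_measurable (M \<Otimes>\<^sub>M lborel)"
      unfolding f_def by measurable
    show "emeasure (M \<Otimes>\<^sub>M lborel) (space M \<times> {0..d}) < \<infinity>"
      using \<open>0 \<le> d\<close> by (subst lborel.emeasure_pair_measure_Times) (auto simp: emeasure_space_1)
  qed (auto simp: f_def indicator_def space_pair_measure)
  have section_y: "(\<integral>z. f z y \<partial>M) = indicator {0..d} y * \<P>(z in M. X z \<le> y)" for y
  proof -
    have "(\<integral>z. f z y \<partial>M)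
        = (\<integral>z. indicator {0..d} y * indicator {z \<in> space M. X z \<le> y} z \<partial>M)"
      by (intro Bochner_Integration.integral_cong) (auto simp: f_def indicator_def)
    then show ?thesis by simp
  qed
  have section_z: "(\<integral>y. f z y \<partial>lborel) = max 0 (d - max 0 (X z))" for z
  proof -
    have "(\<integral>y. f z y \<partial>lborel) = (\<integral>y. indicator {max 0 (X z)..d} y \<partial>lborel)"
      by (intro Bochner_Integration.integral_cong) (auto simp: f_def indicator_def)
    then show ?thesis by (simp add: measure_def max_def)
  qed
  have cdf: "set_integrable lborel {0..d} (\<lambda>y. \<P>(z in M. X z \<le> y))"
    using integrable_snd[OF int] by (simp add: section_y set_integrable_def)
  from set_borel_integral_eq_integral[OF this]
  show "(\<lambda>y. \<P>(z in M. X z \<le> y)) integrable_on {0..d}"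
    and "integral {0..d} (\<lambda>y. \<P>(z in M. X z \<le> y))
      = expectation (\<lambda>z. max 0 (d - max 0 (X z)))"
    using Fubini_integral[OF int]
    by (simp_all add: section_y section_z set_lebesgue_integral_def)
qed

lemma truncated_expectation_eq_integral_cdf:
  assumes "integrable M X" "0 \<le> d"
  shows "d * (\<alpha> - \<P>(z in M. X z < d)) + expectation (\<lambda>z. X z * indicator {0..<d} (X z))
    = integral {0..d} (\<lambda>y. \<alpha> - \<P>(z in M. X z \<le> y))"
proof -
  note [measurable] = borel_measurable_integrable[OF assms(1)]
  have pos_part: "integrable M (\<lambda>z. max 0 (d - max 0 (X z)))"
    using assms(2) by (intro integrable_const_bound[of _ d]) auto
  (* At level 0 the shift formula isolates the part of the difference without \<alpha>. *)
  have "check_loss 0 u - check_loss 0 (u - d) = - max 0 (d - max 0 u)" for u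
    using assms(2) by (auto simp: check_loss_def max_def)
  then have "expectation (\<lambda>z. check_loss 0 (X z)) - expectation (\<lambda>z. check_loss 0 (X z - d))
      = - expectation (\<lambda>z. max 0 (d - max 0 (X z)))"
    using assms(1)
    by (subst Bochner_Integration.integral_diff[symmetric]) (auto intro!: integrable_check_loss)
  then have "d * (0 - \<P>(z in M. X z < d)) + expectation (\<lambda>z. X z * indicator {0..<d} (X z))
      = - integral {0..d} (\<lambda>y. \<P>(z in M. X z \<le> y))"
    using expectation_check_loss_shift[OF assms, of 0] assms(2)
    by (simp add: integral_cdf_eq_expectation(2))
  moreover have "integral {0..d} (\<lambda>y. \<alpha> - \<P>(z in M. X z \<le> y))
      = d * \<alpha> - integral {0..d} (\<lambda>y. \<P>(z in M. X z \<le> y))"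
    using assms(2) integral_cdf_eq_expectation(1)[of X d]
    by (subst Henstock_Kurzweil_Integration.integral_diff) auto
  ultimately show ?thesis by (simp add: algebra_simps)
qed

end

section \<open>The out-of-sample comparison\<close>

theorem mainTheorem5:
  fixes \<alpha> \<epsilon> q \<Delta>s :: real and p :: ereal
    and nrm :: "(real ^ 'n) \<times> real \<Rightarrow> real"
    and Fstar Fhat :: "((real ^ 'n) \<times> real) measure"
    and N :: nat and sample :: "nat \<Rightarrow> (real ^ 'n) \<times> real"
    and \<beta>tilde \<beta>hat :: "real ^ 'n" and stilde shat :: real
    and R :: "(real ^ 'n) \<times> real \<Rightarrow> real"
  assumes "1 / 2 < \<alpha>" and "\<alpha> < 1"
    and "1 < p" and "q = holder_conj p"
    and "0 \<le> \<epsilon>"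
    and "is_norm nrm"
    and "prob_space Fstar" and "sets Fstar = sets borel"
    and "integrable Fstar (\<lambda>z. norm z)"
    and "0 < N" and "Fhat = empirical_distribution N sample"
    and "is_arg_min (regularized_objective nrm \<alpha> p \<epsilon> Fhat) (\<lambda>_. True) (\<beta>tilde, stilde)"
    and "\<Delta>s = \<epsilon> / q * (\<alpha> powr q - (1 - \<alpha>) powr q) * c_const \<alpha> p powr (1 - q)
               * dual_norm nrm (\<beta>tilde, -1)"
    and "(\<beta>hat, shat) = (\<beta>tilde, stilde + \<Delta>s)"
    and "is_arg_min (worst_case_risk nrm \<alpha> p \<epsilon> Fhat) (\<lambda>_. True) (\<beta>hat, shat)"
    and "R = residual \<beta>tilde stilde"
  shows "expected_loss \<alpha> Fstar \<beta>tilde stilde - expected_loss \<alpha> Fstar \<beta>hat shat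
           = \<Delta>s * (\<alpha> - \<P>(z in Fstar. R z < \<Delta>s))
             + (\<integral>z. R z * indicator {0..<\<Delta>s} (R z) \<partial>Fstar)
       \<and> \<Delta>s * (\<alpha> - \<P>(z in Fstar. R z < \<Delta>s))
             + (\<integral>z. R z * indicator {0..<\<Delta>s} (R z) \<partial>Fstar)
           = integral {0..\<Delta>s} (\<lambda>y. \<alpha> - \<P>(z in Fstar. R z \<le> y))"
proof -
  interpret prob_space Fstar by fact
  have "0 < q" using assms(3,4) holder_conj_pos by simp
  moreover have "(1 - \<alpha>) powr q \<le> \<alpha> powr q"
    using assms(1,2) \<open>0 < q\<close> by (intro powr_mono2) auto
  ultimately have shift_nonneg: "0 \<le> \<Delta>s"
    unfolding assms(13) using assms(5) dual_norm_nonneg[OF assms(6)] by simp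
  have int: "integrable Fstar R"
    unfolding assms(16) by (intro integrable_residual assms)
  have hat: "residual \<beta>hat shat z = R z - \<Delta>s" for z
    using assms(14,16) by (simp add: residual_def)
  have "expected_loss \<alpha> Fstar \<beta>tilde stilde - expected_loss \<alpha> Fstar \<beta>hat shat
      = \<Delta>s * (\<alpha> - \<P>(z in Fstar. R z < \<Delta>s))
        + (\<integral>z. R z * indicator {0..<\<Delta>s} (R z) \<partial>Fstar)"
    using expectation_check_loss_shift[OF int shift_nonneg, of \<alpha>]
    by (simp add: expected_loss_def hat assms(16))
  with truncated_expectation_eq_integral_cdf[OF int shift_nonneg, of \<alpha>]
  show ?thesis by simp
qed

end
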